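(* Let $(H,\langle\cdot,\cdot\rangle)$ be an inner product space over $\mathbb{K}$, where $\mathbb{K}=\mathbb{C}$ or $\mathbb{K}=\mathbb{R}$, with norm $\|x\|=\langle x,x\rangle^{1/2}$. Let $a,A\in\mathbb{K}$ be such that $\operatorname{Re}(\overline{a}A)>0$. If $x,y\in H$ are such that $$\operatorname{Re}\langle Ay-x,\,x-ay\rangle\geq 0,$$ then $$\|x\|\,\|y\|\leq \frac12\cdot\frac{\operatorname{Re}\left[A\overline{\langle x,y\rangle}+\overline{a}\langle x,y\rangle\right]}{\left[\operatorname{Re}(\overline{a}A)\right]^{1/2}}\leq \frac12\cdot\frac{|A|+|a|}{\left[\operatorname{Re}(\overline{a}A)\right]^{1/2}}\,|\langle x,y\rangle|.$$ The constant $\frac12$ is sharp in both inequalities: if $H\neq\{0\}$, there is no constant $c<\frac12$ such that $\|x\|\|y\|\leq c\,\frac{\operatorname{Re}[A\overline{\langle x,y\rangle}+\overline{a}\langle x,y\rangle]}{[\operatorname{Re}(\overline{a}A)]^{1/2}}$ holds for all $a,A\in\mathbb{K}$ with $\operatorname{Re}(\overline{a}A)>0$ and all $x,y\in H$ with $\operatorname{Re}\langle Ay-x,\,x-ay\rangle\geq 0$, and there is no constant $c<\frac12$ such that $\|x\|\|y\|\leq c\,\frac{|A|+|a|}{[\operatorname{Re}(\overline{a}A)]^{1/2}}|\langle x,y\rangle|$ holds for all $a,A\in\mathbb{K}$ with $\operatorname{Re}(\overline{a}A)>0$ and all $x,y\in H$ with $\operatorname{Re}\langle Ay-x,\,x-ay\rangle\geq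 0$.
   Context: The inner product is linear in its first argument and conjugate-linear in its second. $\overline{z}$ denotes the complex conjugate of $z$ (and $\overline z=z$, $\operatorname{Re}z=z$ when $\mathbb{K}=\mathbb{R}$). *)

theory Defs
  imports "HOL-Analysis.Inner_Product"
begin

text \<open>
  Complex inner product spaces, in the style of \<^class>\<open>real_inner\<close> but with only the
  algebraic structure. The inner product is linear in the first argument and hence
  conjugate-linear in the second.
\<close>

class complex_inner = ab_group_add +
  fixes scaleC :: "complex \<Rightarrow> 'a \<Rightarrow> 'a" (infixr \<open>*\<^sub>C\<close> 75)
    and cinner :: "'a \<Rightarrow> 'a \<Rightarrow> complex"
  assumes scaleC_add_right: "r *\<^sub>C (x + y) = r *\<^sub>C x + r *\<^sub>C y"
    and scaleC_add_left: "(r + s) *\<^sub>C x = r *\<^sub>C x + s *\<^sub>C x"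
    and scaleC_scaleC: "r *\<^sub>C s *\<^sub>C x = (r * s) *\<^sub>C x"
    and scaleC_one: "1 *\<^sub>C x = x"
    and cinner_commute: "cinner x y = cnj (cinner y x)"
    and cinner_add_left: "cinner (x + y) z = cinner x z + cinner y z"
    and cinner_scaleC_left: "cinner (r *\<^sub>C x) y = r * cinner x y"
    and Re_cinner_ge_zero: "0 \<le> Re (cinner x x)"
    and cinner_eq_zero_iff: "cinner x x = 0 \<longleftrightarrow> x = 0"

definition cnorm :: "'a::complex_inner \<Rightarrow> real"
  where "cnorm x = sqrt (Re (cinner x x))"

instantiation complex :: complex_inner
begin

definition "scaleC r (x :: complex) = r * x"

definition "cinner x (y :: complex) = x * cnj y"

instance
  by standard
    (simp_all add: scaleC_complex_def cinner_complex_def algebra_simps)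

end

lemma cnorm_complex: "cnorm (x :: complex) = cmod x"
  by (simp add: cnorm_def cinner_complex_def cmod_def power2_eq_square)

end

theory Submission imports Defs begin

text \<open>
  Expanding the hypothesis gives
  \<open>\<parallel>x\<parallel>\<^sup>2 + Re (cnj a * A) * \<parallel>y\<parallel>\<^sup>2 \<le> Re (A * cnj \<langle>x, y\<rangle> + cnj a * \<langle>x, y\<rangle>)\<close>, and the left-hand side is at
  least \<open>2 * sqrt (Re (cnj a * A)) * \<parallel>x\<parallel> * \<parallel>y\<parallel>\<close> by AM-GM. Both constants are attained
  for \<open>a = A = 1\<close> and \<open>x = y \<noteq> 0\<close>.
\<close>

text \<open>AM-GM applied to \<open>p\<close> and \<open>sqrt m * q\<close>. It serves both scalar
  fields: \<open>m\<close> is the real part of \<open>cnj a * A\<close> (or \<open>a * A\<close>),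
  \<open>p\<close> and \<open>q\<close> are the norms of \<open>x\<close> and \<open>y\<close>, and
  \<open>R\<close> is the numerator of the middle term.\<close>

lemma mult_le_half_divide_sqrt:
  fixes m p q R :: real
  assumes "m > 0" "p\<^sup>2 + m * q\<^sup>2 \<le> R"
  shows "p * q \<le> 1/2 * (R / sqrt m)"
proof -
  have "0 \<le> (p - sqrt m * q)\<^sup>2"
    by simp
  also have "\<dots> = p\<^sup>2 + m * q\<^sup>2 - 2 * (p * q) * sqrt m"
    using assms(1) by (simp add: power2_diff power_mult_distrib)
  finally have "2 * (p * q) * sqrt m \<le> R"
    using assms(2) by linarith
  then show ?thesis
    using assms(1) by (simp add: field_simps)
qed

text \<open>Reduces the second inequality to a bound on the numerator, with \<open>S\<close> the sum
  of the moduli of \<open>A\<close> and \<open>a\<close>, and \<open>t\<close> the modulus of the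
  inner product.\<close>

lemma half_divide_sqrt_mono:
  fixes m R S t :: real
  assumes "m > 0" "R \<le> S * t"
  shows "1/2 * (R / sqrt m) \<le> 1/2 * (S / sqrt m) * t"
  using divide_right_mono[OF assms(2), of "sqrt m"] assms(1) by simp

lemma cinner_diff_left: "cinner (x - y) z = cinner x z - cinner y z"
  by (metis add_diff_cancel_right' cinner_add_left diff_add_cancel)

lemma cinner_diff_right: "cinner x (y - z) = cinner x y - cinner x z"
  by (metis cinner_commute cinner_diff_left complex_cnj_diff)

lemma cinner_scaleC_right: "cinner x (r *\<^sub>C y) = cnj r * cinner x y"
  by (metis cinner_commute cinner_scaleC_left complex_cnj_mult)

lemma cinner_self: "cinner x x = of_real ((cnorm x)\<^sup>2)"
proof -
  have "Im (cinner x x) = 0"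
    using arg_cong[OF cinner_commute[of x x], of Im] by simp
  then show ?thesis
    by (simp add: complex_eq_iff cnorm_def Re_cinner_ge_zero)
qed

lemma cnorm_eq_zero_iff: "cnorm x = 0 \<longleftrightarrow> x = 0"
  using cinner_eq_zero_iff[of x] by (simp add: cinner_self)

text \<open>Nonnegativity of the left-hand side thereby becomes the second premise of
  \<open>mult_le_half_divide_sqrt\<close>.\<close>

lemma Re_cinner_diff_scaleC:
  "Re (cinner (A *\<^sub>C y - x) (x - a *\<^sub>C y)) =
    Re (A * cnj (cinner x y) + cnj a * cinner x y)
      - ((cnorm x)\<^sup>2 + Re (cnj a * A) * (cnorm y)\<^sup>2)"
proof -
  \<comment> \<open>The identity already holds before taking real parts. Squared norms are real, so
    \<open>Re\<close> then acts only on the coefficient \<open>cnj a * A\<close> and on the mixed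
    terms.\<close>
  have "cinner (A *\<^sub>C y - x) (x - a *\<^sub>C y) =
      A * cnj (cinner x y) + cnj a * cinner x y
        - (of_real ((cnorm x)\<^sup>2) + (cnj a * A) * of_real ((cnorm y)\<^sup>2))"
    unfolding cinner_diff_left cinner_diff_right cinner_scaleC_left cinner_scaleC_right
      cinner_self cinner_commute[of y x, symmetric]
    by (simp add: cinner_commute[of y x] algebra_simps)
  then show ?thesis
    by simp
qed

text \<open>Triangle inequality, together with the fact that conjugation preserves the
  modulus.\<close>

lemma Re_combination_le:
  "Re (A * cnj z + cnj a * z) \<le> (cmod A + cmod a) * cmod z"
proof -
  have "Re (A * cnj z + cnj a * z) \<le> cmod (A * cnj z + cnj a * z)"
    by (rule complex_Re_le_cmod)
  also have "\<dots> \<le> cmod (A * cnj z) + cmod (cnj a * z)"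
    by (rule norm_triangle_ineq)
  finally show ?thesis
    by (simp add: norm_mult algebra_simps)
qed

text \<open>Real counterpart of \<open>Re_cinner_diff_scaleC\<close>: symmetry of
  \<open>inner\<close> merges the two mixed products.\<close>

lemma inner_diff_scaleR:
  fixes x y :: "'a::real_inner"
  shows "inner (A *\<^sub>R y - x) (x - a *\<^sub>R y) =
    A * inner x y + a * inner x y - ((norm x)\<^sup>2 + a * A * (norm y)\<^sup>2)"
  by (simp add: inner_diff_left inner_diff_right power2_norm_eq_inner inner_commute algebra_simps)

lemma abs_combination_le:
  fixes a A z :: real
  shows "A * z + a * z \<le> (\<bar>A\<bar> + \<bar>a\<bar>) * \<bar>z\<bar>"
  by (metis abs_ge_self abs_mult add_mono distrib_right)

theorem theorem3:
  "(
    (\<forall>(a::complex) A (x::'h::complex_inner) y.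
      Re (cnj a * A) > 0 \<longrightarrow>
      Re (cinner (A *\<^sub>C y - x) (x - a *\<^sub>C y)) \<ge> 0 \<longrightarrow>
      cnorm x * cnorm y
        \<le> 1/2 * (Re (A * cnj (cinner x y) + cnj a * cinner x y) / sqrt (Re (cnj a * A))) \<and>
      1/2 * (Re (A * cnj (cinner x y) + cnj a * cinner x y) / sqrt (Re (cnj a * A)))
        \<le> 1/2 * ((cmod A + cmod a) / sqrt (Re (cnj a * A))) * cmod (cinner x y)) \<and>
    ((\<exists>h::'h. h \<noteq> 0) \<longrightarrow>
      \<not> (\<exists>c::real. c < 1/2 \<and>
        (\<forall>(a::complex) A (x::'h) y.
          Re (cnj a * A) > 0 \<longrightarrow>
          Re (cinner (A *\<^sub>C y - x) (x - a *\<^sub>C y)) \<ge> 0 \<longrightarrow>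
          cnorm x * cnorm y
            \<le> c * (Re (A * cnj (cinner x y) + cnj a * cinner x y) / sqrt (Re (cnj a * A))))) \<and>
      \<not> (\<exists>c::real. c < 1/2 \<and>
        (\<forall>(a::complex) A (x::'h) y.
          Re (cnj a * A) > 0 \<longrightarrow>
          Re (cinner (A *\<^sub>C y - x) (x - a *\<^sub>C y)) \<ge> 0 \<longrightarrow>
          cnorm x * cnorm y
            \<le> c * ((cmod A + cmod a) / sqrt (Re (cnj a * A))) * cmod (cinner x y)))))
   \<and>
   (
    (\<forall>(a::real) A (x::'r::real_inner) y.
      a * A > 0 \<longrightarrow>
      inner (A *\<^sub>R y - x) (x - a *\<^sub>R y) \<ge> 0 \<longrightarrow>
      norm x * norm y
        \<le> 1/2 * ((A * inner x y + a * inner x y) / sqrt (a * A)) \<and>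
      1/2 * ((A * inner x y + a * inner x y) / sqrt (a * A))
        \<le> 1/2 * ((\<bar>A\<bar> + \<bar>a\<bar>) / sqrt (a * A)) * \<bar>inner x y\<bar>) \<and>
    ((\<exists>h::'r. h \<noteq> 0) \<longrightarrow>
      \<not> (\<exists>c::real. c < 1/2 \<and>
        (\<forall>(a::real) A (x::'r) y.
          a * A > 0 \<longrightarrow>
          inner (A *\<^sub>R y - x) (x - a *\<^sub>R y) \<ge> 0 \<longrightarrow>
          norm x * norm y
            \<le> c * ((A * inner x y + a * inner x y) / sqrt (a * A)))) \<and>
      \<not> (\<exists>c::real. c < 1/2 \<and>
        (\<forall>(a::real) A (x::'r) y.
          a * A > 0 \<longrightarrow>
          inner (A *\<^sub>R y - x) (x - a *\<^sub>R y) \<ge> 0 \<longrightarrow>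
          norm x * norm y
            \<le> c * ((\<bar>A\<bar> + \<bar>a\<bar>) / sqrt (a * A)) * \<bar>inner x y\<bar>))))"
proof (intro conjI allI impI, goal_cases)
  case (1 a A x y)
  then show ?case
    by (intro mult_le_half_divide_sqrt) (simp_all only: Re_cinner_diff_scaleC diff_ge_0_iff_ge)
next
  case (2 a A x y)
  then show ?case
    by (intro half_divide_sqrt_mono Re_combination_le)
next
  case 3
  then obtain h :: 'h where "h \<noteq> 0" by blast
  then have pos: "(cnorm h)\<^sup>2 > 0"
    by (simp add: cnorm_eq_zero_iff)
  show ?case
  proof (rule notI, elim exE conjE, goal_cases)
    case (1 c)
    \<comment> \<open>For \<open>a = A = 1\<close> and \<open>x = y = h\<close> both arguments of
      the inner product in the hypothesis vanish, so it holds trivially. The assumed bound reads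
      \<open>(cnorm h)\<^sup>2 \<le> 2 * c * (cnorm h)\<^sup>2\<close>, which fails for
      \<open>c < 1/2\<close>.\<close>
    from 1(2)[rule_format, of 1 1 h h] have "(1 - 2 * c) * (cnorm h)\<^sup>2 \<le> 0"
      by (simp add: scaleC_one cinner_self power2_eq_square algebra_simps)
    with pos \<open>c < 1/2\<close> show ?case
      by (simp add: mult_le_0_iff)
  qed
next
  case 4
  then obtain h :: 'h where "h \<noteq> 0" by blast
  then have pos: "(cnorm h)\<^sup>2 > 0"
    by (simp add: cnorm_eq_zero_iff)
  show ?case
  proof (rule notI, elim exE conjE, goal_cases)
    case (1 c)
    \<comment> \<open>The same witness works: the moduli of \<open>A\<close> and \<open>a\<close>
      sum to 2, and \<open>cinner h h\<close> equals its own modulus.\<close>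
    from 1(2)[rule_format, of 1 1 h h] have "(1 - 2 * c) * (cnorm h)\<^sup>2 \<le> 0"
      by (simp add: scaleC_one cinner_self norm_mult power2_eq_square algebra_simps)
    with pos \<open>c < 1/2\<close> show ?case
      by (simp add: mult_le_0_iff)
  qed
next
  case (5 a A x y)
  then show ?case
    by (intro mult_le_half_divide_sqrt) (simp_all only: inner_diff_scaleR diff_ge_0_iff_ge)
next
  case (6 a A x y)
  then show ?case
    by (intro half_divide_sqrt_mono abs_combination_le)
next
  case 7
  then obtain h :: 'r where "h \<noteq> 0" by blast
  then have pos: "(norm h)\<^sup>2 > 0"
    by simp
  show ?case
  proof (rule notI, elim exE conjE, goal_cases)
    case (1 c)
    \<comment> \<open>The witness of the complex case carries over, since its scalars are
      real.\<close>
    from 1(2)[rule_format, of 1 1 h h] have "(1 - 2 * c) * (norm h)\<^sup>2 \<le> 0"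
      by (simp add: power2_norm_eq_inner[symmetric] power2_eq_square algebra_simps)
    with pos \<open>c < 1/2\<close> show ?case
      by (simp add: mult_le_0_iff)
  qed
next
  case 8
  then obtain h :: 'r where "h \<noteq> 0" by blast
  then have pos: "(norm h)\<^sup>2 > 0"
    by simp
  show ?case
  proof (rule notI, elim exE conjE, goal_cases)
    case (1 c)
    from 1(2)[rule_format, of 1 1 h h] have "(1 - 2 * c) * (norm h)\<^sup>2 \<le> 0"
      by (simp add: power2_norm_eq_inner[symmetric] power2_eq_square algebra_simps)
    with pos \<open>c < 1/2\<close> show ?case
      by (simp add: mult_le_0_iff)
  qed
qed

end
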